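(* The set $I^{\forall^\infty}_{TD^+} = \{e : (\forall^\infty L \in \mathcal L_e)[\mathrm{TD}^+(L,\mathcal L_e) < \infty]\}$ is $\Sigma^0_5$-complete.
   Context: $W_0,W_1,\ldots$ is an acceptable numbering of all r.e. subsets of $\mathbb N$; $L^e_j = \{x : \langle j,x\rangle \in W_e\}$ and $\mathcal L_e = \{L^e_j : j\in\mathbb N\}$. $\forall^\infty$ means "for all but finitely many". For a family $\mathcal L$ of subsets of $\mathbb N$ and $L\in\mathcal L$, a positive teaching set for $L$ w.r.t. $\mathcal L$ is a set $S\subseteq L$ such that no $L'\in\mathcal L\setminus\{L\}$ satisfies $S\subseteq L'$; $\mathrm{TD}^+(L,\mathcal L)$ is the smallest size of such a set ($\infty$ if there is no finite one). $\Sigma^0_n$-complete means definable by a $\Sigma^0_n$ formula and every $\Sigma^0_n$ set many-one reduces to it via a recursive function. *)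

theory Defs
  imports Complex_Main "HOL-Library.Nat_Bijection" "HOL-Library.Extended_Nat"
    "HOL-Library.Infinite_Set"
begin

(* Total recursive functions of n arguments, given as lists of length n, as the closure of the
   initial functions under composition, primitive recursion and minimization restricted to
   regular functions.  By the last rule, values on lists of any other length are irrelevant. *)
inductive recursive :: "nat \<Rightarrow> (nat list \<Rightarrow> nat) \<Rightarrow> bool" where
  zero: "recursive n (\<lambda>xs. 0)"
| succ: "recursive 1 (\<lambda>xs. Suc (xs ! 0))"
| proj: "i < n \<Longrightarrow> recursive n (\<lambda>xs. xs ! i)"
| comp: "recursive m f \<Longrightarrow> length gs = m \<Longrightarrow> (\<forall>g\<in>set gs. recursive n g)
    \<Longrightarrow> recursive n (\<lambda>xs. f (map (\<lambda>g. g xs) gs))"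
| prim_rec: "recursive n f \<Longrightarrow> recursive (Suc (Suc n)) g
    \<Longrightarrow> recursive (Suc n)
          (\<lambda>xs. rec_nat (f (tl xs)) (\<lambda>k r. g (k # r # tl xs)) (hd xs))"
| minim: "recursive (Suc n) f \<Longrightarrow> (\<forall>xs. length xs = n \<longrightarrow> (\<exists>k. f (k # xs) = 0))
    \<Longrightarrow> recursive n (\<lambda>xs. LEAST k. f (k # xs) = 0)"
| cong: "recursive n f \<Longrightarrow> (\<forall>xs. length xs = n \<longrightarrow> g xs = f xs) \<Longrightarrow> recursive n g"

definition recursive_fun :: "(nat \<Rightarrow> nat) \<Rightarrow> bool" where
  "recursive_fun f \<longleftrightarrow> recursive 1 (\<lambda>xs. f (xs ! 0))"

definition recursive_rel :: "nat \<Rightarrow> (nat list \<Rightarrow> bool) \<Rightarrow> bool" where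
  "recursive_rel n R \<longleftrightarrow> recursive n (\<lambda>xs. of_bool (R xs))"

definition re :: "nat set \<Rightarrow> bool" where
  "re A \<longleftrightarrow> A = {} \<or> (\<exists>f. recursive_fun f \<and> A = range f)"

(* The sequence V 0, V 1, ... is uniformly r.e.; prod_encode is Cantor's pairing function. *)
definition uniformly_re :: "(nat \<Rightarrow> nat set) \<Rightarrow> bool" where
  "uniformly_re V \<longleftrightarrow> re {prod_encode (i, x) | i x. x \<in> V i}"

(* Rogers' notion for r.e. sets: W is uniformly r.e., and an index in any uniformly r.e. sequence
   can be translated effectively into a W-index.  Taking V constant, W lists every r.e. set. *)
definition acceptable_numbering :: "(nat \<Rightarrow> nat set) \<Rightarrow> bool" where
  "acceptable_numbering W \<longleftrightarrow> uniformly_re W \<and>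
     (\<forall>V. uniformly_re V \<longrightarrow> (\<exists>f. recursive_fun f \<and> (\<forall>i. V i = W (f i))))"

(* ex_prefix n R xs says: exists y1, for all y2, exists y3, ... (n alternating quantifiers)
   such that R holds of xs @ [y1, ..., yn]; all_prefix starts with a universal quantifier. *)
fun ex_prefix :: "nat \<Rightarrow> (nat list \<Rightarrow> bool) \<Rightarrow> nat list \<Rightarrow> bool"
  and all_prefix :: "nat \<Rightarrow> (nat list \<Rightarrow> bool) \<Rightarrow> nat list \<Rightarrow> bool" where
  "ex_prefix 0 R xs = R xs"
| "ex_prefix (Suc n) R xs = (\<exists>y. all_prefix n R (xs @ [y]))"
| "all_prefix 0 R xs = R xs"
| "all_prefix (Suc n) R xs = (\<forall>y. ex_prefix n R (xs @ [y]))"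

definition Sigma0 :: "nat \<Rightarrow> nat set \<Rightarrow> bool" where
  "Sigma0 n A \<longleftrightarrow>
     (\<exists>R. recursive_rel (Suc n) R \<and> (\<forall>x. x \<in> A \<longleftrightarrow> ex_prefix n R [x]))"

definition many_one_reducible :: "nat set \<Rightarrow> nat set \<Rightarrow> bool" where
  "many_one_reducible A B \<longleftrightarrow> (\<exists>f. recursive_fun f \<and> (\<forall>x. x \<in> A \<longleftrightarrow> f x \<in> B))"

definition Sigma0_complete :: "nat \<Rightarrow> nat set \<Rightarrow> bool" where
  "Sigma0_complete n A \<longleftrightarrow> Sigma0 n A \<and> (\<forall>B. Sigma0 n B \<longrightarrow> many_one_reducible B A)"

definition lang :: "(nat \<Rightarrow> nat set) \<Rightarrow> nat \<Rightarrow> nat \<Rightarrow> nat set" where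
  "lang W e j = {x. prod_encode (j, x) \<in> W e}"

definition family :: "(nat \<Rightarrow> nat set) \<Rightarrow> nat \<Rightarrow> nat set set" where
  "family W e = {lang W e j | j. True}"

definition pos_teaching_set :: "nat set \<Rightarrow> nat set \<Rightarrow> nat set set \<Rightarrow> bool" where
  "pos_teaching_set S L \<L> \<longleftrightarrow> S \<subseteq> L \<and> \<not> (\<exists>L'\<in>\<L> - {L}. S \<subseteq> L')"

(* The infimum of the empty set in enat is infinity. *)
definition TD_pos :: "nat set \<Rightarrow> nat set set \<Rightarrow> enat" where
  "TD_pos L \<L> = (INF S \<in> {S. finite S \<and> pos_teaching_set S L \<L>}. enat (card S))"

(* The exceptions are counted as distinct languages of the family, not as indices j. *)
definition I_cofin_TD_pos :: "(nat \<Rightarrow> nat set) \<Rightarrow> nat set" where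
  "I_cofin_TD_pos W =
     {e. \<forall>\<^sub>\<infinity>L. L \<in> family W e \<longrightarrow> TD_pos L (family W e) < \<infinity>}"

end

theory Submission
  imports Defs
begin

text \<open>Upper bound: only finitely many languages of the family fail to be taught iff, for some \<open>k\<close>,
  every language with an index \<open>j\<close> either has an index below \<open>k\<close> (\<open>\<Pi>\<^sub>2\<close>) or is taught by some finite
  stage of its own enumeration (\<open>\<Sigma>\<^sub>3\<close>), which makes the quantifier prefix \<open>\<Sigma>\<^sub>5\<close>.

  Hardness: let \<open>B\<close> be \<open>\<Sigma>\<^sub>5\<close>. As witnesses of \<open>\<Sigma>\<^sub>4\<close> statements can be made unique, \<open>x \<notin> B\<close> is
  equivalent to \<open>\<forall>y. \<exists>!w. P x y w\<close> with \<open>P\<close> in \<open>\<Pi>\<^sub>3\<close>. Hence \<open>x \<in> B\<close> iff only finitely many finite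
  sequences \<open>v = (w\<^sub>0, \<dots>)\<close> satisfy \<open>P x i w\<^sub>i\<close> throughout, which is a \<open>\<Pi>\<^sub>3\<close> condition on \<open>v\<close>. Its
  negation has the form \<open>\<exists>a. \<forall>t. D v a t\<close> with \<open>D\<close> in \<open>\<Sigma>\<^sub>1\<close>, and each \<open>v\<close> contributes to the family one
  language together with approximations to it, numbered by \<open>a\<close>, such that the former fails to be
  taught iff infinitely many (equivalently, all) approximations differ from it.\<close>

section \<open>Closure properties of recursive functions\<close>

abbreviation pair :: "nat \<Rightarrow> nat \<Rightarrow> nat" where
  "pair a b \<equiv> prod_encode (a, b)"

definition pfst :: "nat \<Rightarrow> nat" where
  "pfst c = fst (prod_decode c)"

definition psnd :: "nat \<Rightarrow> nat" where
  "psnd c = snd (prod_decode c)"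

lemma pfst_pair [simp]: "pfst (pair a b) = a"
  and psnd_pair [simp]: "psnd (pair a b) = b"
  by (simp_all add: pfst_def psnd_def)

lemma pair_pfst_psnd [simp]: "pair (pfst c) (psnd c) = c"
  by (simp add: pfst_def psnd_def)

section \<open>Composition, primitive recursion and arithmetic\<close>

lemma recursive_comp1:
  assumes "recursive 1 (\<lambda>xs. f (xs ! 0))" "recursive n F"
  shows "recursive n (\<lambda>xs. f (F xs))"
  using recursive.comp[OF assms(1), of "[F]" n] assms(2) by simp

lemma recursive_comp2:
  assumes "recursive 2 (\<lambda>xs. f (xs ! 0) (xs ! 1))" "recursive n F" "recursive n G"
  shows "recursive n (\<lambda>xs. f (F xs) (G xs))"
  using recursive.comp[OF assms(1), of "[F, G]" n] assms(2-) by simp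

text \<open>The generating rule addresses its arguments by \<open>hd\<close> and \<open>tl\<close>;
  \<open>cong\<close> permits replacing them by positions, because only lists of length 2
  matter.\<close>

lemma recursive_prim_rec2:
  assumes "recursive 1 (\<lambda>xs. f (xs ! 0))"
    and "recursive 3 (\<lambda>xs. g (xs ! 0) (xs ! 1) (xs ! 2))"
  shows "recursive 2 (\<lambda>xs. rec_nat (f (xs ! 1)) (\<lambda>k r. g k r (xs ! 1)) (xs ! 0))"
proof -
  have "recursive (Suc (Suc 1)) (\<lambda>xs. g (xs ! 0) (xs ! 1) (xs ! 2))"
    using assms(2) by (simp add: numeral_3_eq_3)
  from recursive.prim_rec[OF assms(1) this]
  have "recursive 2 (\<lambda>xs. rec_nat (f (tl xs ! 0)) (\<lambda>k r. g k r (tl xs ! 0)) (hd xs))"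
    by (simp add: numeral_2_eq_2)
  then show ?thesis
    by (rule recursive.cong) (auto simp: numeral_2_eq_2 length_Suc_conv)
qed

lemma recursive_rec_nat:
  assumes "recursive 1 (\<lambda>xs. f (xs ! 0))"
    and "recursive 3 (\<lambda>xs. g (xs ! 0) (xs ! 1) (xs ! 2))"
    and "recursive n M" "recursive n X"
  shows "recursive n (\<lambda>xs. rec_nat (f (X xs)) (\<lambda>k r. g k r (X xs)) (M xs))"
  using recursive_comp2[OF recursive_prim_rec2[OF assms(1,2)] assms(3,4)] .

lemma recursive_Suc:
  "recursive n F \<Longrightarrow> recursive n (\<lambda>xs. Suc (F xs))"
  by (rule recursive_comp1[OF recursive.succ])

lemma recursive_const: "recursive n (\<lambda>xs. c)"
  by (induction c) (auto intro: recursive.zero recursive_Suc)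

lemmas recursive_intros = recursive.zero recursive.proj recursive_Suc

lemma recursive_add:
  assumes "recursive n F" "recursive n G"
  shows "recursive n (\<lambda>xs. F xs + G xs)"
proof -
  have eq: "rec_nat y (\<lambda>k r. Suc r) x = x + y" for x y :: nat
    by (induction x) auto
  have "recursive n (\<lambda>xs. rec_nat (G xs) (\<lambda>k r. Suc r) (F xs))"
    by (rule recursive_rec_nat[of "\<lambda>y. y" "\<lambda>k r y. Suc r" n "\<lambda>xs. F xs" "\<lambda>xs. G xs"])
      (intro recursive_intros assms; simp)+
  then show ?thesis
    by (simp only: eq)
qed

lemma recursive_pred:
  assumes "recursive n F"
  shows "recursive n (\<lambda>xs. F xs - 1)"
proof -
  have eq: "rec_nat 0 (\<lambda>k r. k) x = x - 1" for x y :: nat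
    by (induction x) auto
  have "recursive n (\<lambda>xs. rec_nat (0) (\<lambda>k r. k) (F xs))"
    by (rule recursive_rec_nat[of "\<lambda>y. 0" "\<lambda>k r y. k" n "\<lambda>xs. F xs" "\<lambda>xs. F xs"])
      (intro recursive_intros assms; simp)+
  then show ?thesis
    by (simp only: eq)
qed

lemma recursive_diff:
  assumes "recursive n F" "recursive n G"
  shows "recursive n (\<lambda>xs. F xs - G xs)"
proof -
  have eq: "rec_nat y (\<lambda>k r. r - 1) x = y - x" for x y :: nat
    by (induction x) auto
  have "recursive n (\<lambda>xs. rec_nat (F xs) (\<lambda>k r. r - 1) (G xs))"
    by (rule recursive_rec_nat[of "\<lambda>y. y" "\<lambda>k r y. r - 1" n "\<lambda>xs. G xs" "\<lambda>xs. F xs"])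
      (intro recursive_pred recursive_intros assms; simp)+
  then show ?thesis
    by (simp only: eq)
qed

lemma recursive_mult:
  assumes "recursive n F" "recursive n G"
  shows "recursive n (\<lambda>xs. F xs * G xs)"
proof -
  have eq: "rec_nat 0 (\<lambda>k r. r + y) x = x * y" for x y :: nat
    by (induction x) auto
  have "recursive n (\<lambda>xs. rec_nat (0) (\<lambda>k r. r + G xs) (F xs))"
    by (rule recursive_rec_nat[of "\<lambda>y. 0" "\<lambda>k r y. r + y" n "\<lambda>xs. F xs" "\<lambda>xs. G xs"])
      (intro recursive_add recursive_intros assms; simp)+
  then show ?thesis
    by (simp only: eq)
qed

section \<open>Cantor pairing and its inverses\<close>

lemma recursive_triangle:
  assumes "recursive n F"
  shows "recursive n (\<lambda>xs. triangle (F xs))"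
proof -
  have eq: "rec_nat 0 (\<lambda>k r. r + Suc k) x = triangle x" for x :: nat
    by (induction x) auto
  have "recursive n (\<lambda>xs. rec_nat (0) (\<lambda>k r. r + Suc k) (F xs))"
    by (rule recursive_rec_nat[of "\<lambda>y. 0" "\<lambda>k r y. r + Suc k" n "\<lambda>xs. F xs" "\<lambda>xs. F xs"])
      (intro recursive_add recursive_intros assms; simp)+
  then show ?thesis
    by (simp only: eq)
qed

lemma recursive_pair:
  assumes "recursive n F" "recursive n G"
  shows "recursive n (\<lambda>xs. pair (F xs) (G xs))"
  unfolding prod_encode_def by (simp add: assms recursive_add recursive_triangle)

text \<open>For \<open>c = pair a b\<close> this is \<open>a + b\<close>, the antidiagonal on which
  \<open>c\<close> lies: the least \<open>s\<close> with \<open>c < triangle (Suc s)\<close>.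
  Truncated subtraction turns the inequality into the equation with 0 that \<open>minim\<close>
  searches for.\<close>

definition diagonal :: "nat \<Rightarrow> nat" where
  "diagonal c = (LEAST s. Suc c - triangle (Suc s) = 0)"

lemma le_triangle: "n \<le> triangle n"
  by (induction n) auto

lemma recursive_diagonal: "recursive 1 (\<lambda>xs. diagonal (xs ! 0))"
  unfolding diagonal_def
proof -
  have r: "recursive (Suc 1) (\<lambda>xs. Suc (xs ! 1) - triangle (Suc (xs ! 0)))"
    by (intro recursive_diff recursive_Suc recursive_triangle recursive.proj) auto
  \<comment> \<open>The argument itself solves the equation, because a triangular number is at least
    its index; this is the regularity that \<open>minim\<close> demands.\<close>
  have "\<exists>k. Suc ((k # xs) ! 1) - triangle (Suc ((k # xs) ! 0)) = 0" for xs
    using le_triangle[of "Suc (xs ! 0)"] by (intro exI[of _ "xs ! 0"]) simp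
  then show "recursive 1 (\<lambda>xs. LEAST s. Suc (xs ! 0) - triangle (Suc s) = 0)"
    using recursive.minim[OF r] by simp
qed

lemma diagonal_pair: "diagonal (pair a b) = a + b"
  unfolding diagonal_def prod_encode_def
proof (rule Least_equality)
  show "Suc (case (a, b) of (m, n) \<Rightarrow> triangle (m + n) + m) - triangle (Suc (a + b)) = 0"
    by simp
next
  fix s assume "Suc (case (a, b) of (m, n) \<Rightarrow> triangle (m + n) + m) - triangle (Suc s) = 0"
  then have lt: "triangle (a + b) + a < triangle (Suc s)"
    by simp
  show "a + b \<le> s"
  proof (rule ccontr)
    assume "\<not> a + b \<le> s"
    then have "triangle (Suc s) \<le> triangle (a + b)"
      using monoD[OF incseq_SucI[of triangle], of "Suc s" "a + b"] by simp
    with lt show False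
      by linarith
  qed
qed

text \<open>Cantor's code is \<open>triangle (a + b) + a\<close>, so subtracting the triangular
  number of the antidiagonal leaves \<open>a\<close>.\<close>

lemma pfst_eq: "pfst c = c - triangle (diagonal c)"
proof -
  obtain a b where "c = pair a b"
    by (metis pair_pfst_psnd)
  then show ?thesis
    by (simp add: diagonal_pair) (simp add: prod_encode_def)
qed

lemma psnd_eq: "psnd c = diagonal c - pfst c"
proof -
  obtain a b where "c = pair a b"
    by (metis pair_pfst_psnd)
  then show ?thesis
    by (simp add: diagonal_pair)
qed

section \<open>Unary recursive functions and decidable predicates\<close>

lemma recursive_fun_comp:
  "recursive_fun f \<Longrightarrow> recursive_fun g \<Longrightarrow> recursive_fun (\<lambda>x. f (g x))"
  unfolding recursive_fun_def by (rule recursive_comp1)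

lemma recursive_fun_id: "recursive_fun (\<lambda>x. x)"
  by (simp add: recursive_fun_def recursive.proj)

lemma recursive_fun_pfst0: "recursive_fun pfst"
  unfolding recursive_fun_def pfst_eq
  by (intro recursive_diff recursive_triangle recursive_diagonal recursive.proj) auto

lemma recursive_fun_psnd0: "recursive_fun psnd"
  unfolding recursive_fun_def psnd_eq
  by (intro recursive_diff recursive_fun_pfst0[unfolded recursive_fun_def] recursive_diagonal)

lemmas recursive_fun_pfst = recursive_fun_comp[OF recursive_fun_pfst0]
lemmas recursive_fun_psnd = recursive_fun_comp[OF recursive_fun_psnd0]

text \<open>The three arguments of the step function are coded by one number \<open>c\<close>, in
  the order parameter, counter, recursive value, so that all hypotheses are about unary
  functions.\<close>

lemma recursive_fun_rec_nat:
  assumes "recursive_fun f" "recursive_fun (\<lambda>c. g (pfst (psnd c)) (psnd (psnd c)) (pfst c))"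
    and "recursive_fun m"
  shows "recursive_fun (\<lambda>x. rec_nat (f x) (\<lambda>k r. g k r x) (m x))"
proof -
  have "recursive 3 (\<lambda>xs. g (xs ! 0) (xs ! 1) (xs ! 2))"
    using recursive_comp1[OF assms(2)[unfolded recursive_fun_def],
        of 3 "\<lambda>xs. pair (xs ! 2) (pair (xs ! 0) (xs ! 1))"]
    by (simp add: recursive_pair recursive.proj)
  then show ?thesis
    unfolding recursive_fun_def
    by (rule recursive_rec_nat[where X = "\<lambda>xs. xs ! 0",
          OF assms(1)[unfolded recursive_fun_def] _ assms(3)[unfolded recursive_fun_def]])
      (simp add: recursive.proj)
qed

definition decidable :: "(nat \<Rightarrow> bool) \<Rightarrow> bool" where
  "decidable P \<longleftrightarrow> recursive_fun (\<lambda>x. of_bool (P x))"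

named_theorems rec_intros

lemma recursive_fun_intros [rec_intros]:
  "recursive_fun (\<lambda>x. x)"
  "recursive_fun (\<lambda>x. c)"
  "recursive_fun f \<Longrightarrow> recursive_fun (\<lambda>x. Suc (f x))"
  "recursive_fun f \<Longrightarrow> recursive_fun (\<lambda>x. pfst (f x))"
  "recursive_fun f \<Longrightarrow> recursive_fun (\<lambda>x. psnd (f x))"
  "recursive_fun f \<Longrightarrow> recursive_fun g \<Longrightarrow> recursive_fun (\<lambda>x. pair (f x) (g x))"
  "recursive_fun f \<Longrightarrow> recursive_fun g \<Longrightarrow> recursive_fun (\<lambda>x. f x - g x)"
  by (fact recursive_fun_id recursive_fun_pfst recursive_fun_psnd
      | simp add: recursive_fun_def recursive_const recursive_Suc recursive_pair recursive_diff)+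

lemma recursive_fun_if [rec_intros]:
  assumes "decidable P" "recursive_fun f" "recursive_fun g"
  shows "recursive_fun (\<lambda>x. if P x then f x else g x)"
proof -
  have "(\<lambda>x. if P x then f x else g x) = (\<lambda>x. of_bool (P x) * f x + (1 - of_bool (P x)) * g x)"
    by auto
  with assms show ?thesis
    by (simp only: decidable_def recursive_fun_def)
      (intro recursive_add recursive_mult recursive_diff recursive_const)
qed

lemma recursive_fun_funpow [rec_intros]:
  assumes "recursive_fun h" "recursive_fun m" "recursive_fun f"
  shows "recursive_fun (\<lambda>x. (h ^^ m x) (f x))"
proof -
  have eq: "rec_nat a (\<lambda>k r. h r) n = (h ^^ n) a" for a n
    by (induction n) auto
  have "recursive_fun (\<lambda>c. h (psnd (psnd c)))"
    by (intro recursive_fun_comp[OF assms(1)] rec_intros)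
  from recursive_fun_rec_nat[of f "\<lambda>k r x. h r", OF assms(3) this assms(2)]
  show ?thesis
    by (simp add: eq)
qed

lemma decidable_not [rec_intros]:
  assumes "decidable P"
  shows "decidable (\<lambda>x. \<not> P x)"
proof -
  have "(\<lambda>x. of_bool (\<not> P x)) = (\<lambda>x. 1 - of_bool (P x) :: nat)"
    by auto
  with assms show ?thesis
    by (simp only: decidable_def) (intro recursive_fun_intros)
qed

lemma decidable_conj [rec_intros]:
  assumes "decidable P" "decidable Q"
  shows "decidable (\<lambda>x. P x \<and> Q x)"
proof -
  have "(\<lambda>x. of_bool (P x \<and> Q x)) = (\<lambda>x. of_bool (P x) * of_bool (Q x) :: nat)"
    by auto
  with assms show ?thesis
    by (simp only: decidable_def recursive_fun_def) (intro recursive_mult)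
qed

lemma decidable_disj [rec_intros]:
  assumes "decidable P" "decidable Q"
  shows "decidable (\<lambda>x. P x \<or> Q x)"
proof -
  have "decidable (\<lambda>x. \<not> (\<not> P x \<and> \<not> Q x))"
    by (intro decidable_not decidable_conj assms)
  then show ?thesis
    by simp
qed

lemma decidable_le [rec_intros]:
  assumes "recursive_fun f" "recursive_fun g"
  shows "decidable (\<lambda>x. f x \<le> g x)"
proof -
  have "(\<lambda>x. of_bool (f x \<le> g x)) = (\<lambda>x. 1 - (f x - g x))"
    by (auto simp: fun_eq_iff)
  with assms show ?thesis
    by (simp only: decidable_def) (intro rec_intros)
qed

lemma decidable_less [rec_intros]:
  assumes "recursive_fun f" "recursive_fun g"
  shows "decidable (\<lambda>x. f x < g x)"
  unfolding not_le [symmetric] by (intro decidable_not decidable_le assms)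

lemma decidable_eq [rec_intros]:
  assumes "recursive_fun f" "recursive_fun g"
  shows "decidable (\<lambda>x. f x = g x)"
  unfolding eq_iff by (intro decidable_conj decidable_le assms)

lemma decidable_subst:
  "decidable P \<Longrightarrow> recursive_fun f \<Longrightarrow> decidable (\<lambda>x. P (f x))"
  unfolding decidable_def by (rule recursive_fun_comp)

text \<open>The truth value is the product of those of \<open>P x k\<close>, computed by primitive
  recursion on the bound.\<close>

lemma decidable_all_less [rec_intros]:
  assumes "decidable (\<lambda>c. P (pfst c) (psnd c))" "recursive_fun m"
  shows "decidable (\<lambda>x. \<forall>k<m x. P x k)"
proof -
  have eq: "rec_nat 1 (\<lambda>k r. r * of_bool (P x k)) n = (of_bool (\<forall>k<n. P x k) :: nat)" for x n
    by (induction n) (auto simp: less_Suc_eq)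
  have "recursive_fun (\<lambda>c. of_bool (P (pfst c) (pfst (psnd c))))"
    using recursive_fun_comp[OF assms(1)[unfolded decidable_def],
        of "\<lambda>c. pair (pfst c) (pfst (psnd c))"]
    by (simp add: recursive_fun_intros)
  moreover have "recursive_fun (\<lambda>c. psnd (psnd c))"
    by (intro recursive_fun_intros)
  ultimately have "recursive_fun (\<lambda>c. psnd (psnd c) * of_bool (P (pfst c) (pfst (psnd c))))"
    unfolding recursive_fun_def by (intro recursive_mult)
  from recursive_fun_rec_nat[of "\<lambda>x. 1" "\<lambda>k r x. r * of_bool (P x k)", OF _ this assms(2)]
  show ?thesis
    unfolding decidable_def eq by (simp add: rec_intros)
qed

lemma decidable_ex_less [rec_intros]:
  assumes "decidable (\<lambda>c. P (pfst c) (psnd c))" "recursive_fun m"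
  shows "decidable (\<lambda>x. \<exists>k<m x. P x k)"
proof -
  have "decidable (\<lambda>x. \<not> (\<forall>k<m x. \<not> P x k))"
    by (intro decidable_not decidable_all_less assms)
  then show ?thesis
    by simp
qed

section \<open>The arithmetical hierarchy on predicates\<close>

lemma decidable_const [rec_intros]: "decidable (\<lambda>x. b)"
  unfolding decidable_def by (intro rec_intros)

section \<open>Codes of finite sequences\<close>

definition entry :: "nat \<Rightarrow> nat \<Rightarrow> nat" where
  "entry s i = psnd ((pfst ^^ i) s)"

text \<open>A code is a nest of pairs in the first component, ending in 0. As
  \<open>pfst 0 = 0\<close>, one number can code sequences of several lengths, so \<open>m\<close>
  is given separately; for fixed \<open>m\<close>, reaching 0 after \<open>m\<close> steps makes the
  code unique.\<close>

definition codes_seq :: "nat \<Rightarrow> nat \<Rightarrow> bool" where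
  "codes_seq m s \<longleftrightarrow> (pfst ^^ m) s = 0"

lemma entry_0: "entry s 0 = psnd s"
  and entry_Suc: "entry s (Suc i) = entry (pfst s) i"
  by (simp_all add: entry_def funpow_swap1)

lemma codes_seq_Suc: "codes_seq (Suc m) s \<longleftrightarrow> codes_seq m (pfst s)"
  by (simp add: codes_seq_def funpow_swap1)

lemma ex_codes_seq: "\<exists>s. codes_seq m s \<and> (\<forall>i<m. entry s i = w i)"
proof (induction m arbitrary: w)
  case 0
  show ?case
    by (simp add: codes_seq_def)
next
  case (Suc m)
  from Suc[of "\<lambda>i. w (Suc i)"] obtain s
    where "codes_seq m s" "\<forall>i<m. entry s i = w (Suc i)"
    by blast
  then have "codes_seq (Suc m) (pair s (w 0)) \<and> (\<forall>i<Suc m. entry (pair s (w 0)) i = w i)"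
    by (auto simp: codes_seq_Suc entry_0 entry_Suc less_Suc_eq_0_disj)
  then show ?case
    by blast
qed

lemma codes_seq_inject:
  "codes_seq m s \<Longrightarrow> codes_seq m t \<Longrightarrow> (\<And>i. i < m \<Longrightarrow> entry s i = entry t i) \<Longrightarrow> s = t"
proof (induction m arbitrary: s t)
  case 0
  then show ?case
    by (simp add: codes_seq_def)
next
  case (Suc m)
  have "pfst s = pfst t"
    using Suc.prems Suc.IH[of "pfst s" "pfst t"]
    by (metis Suc_mono codes_seq_Suc entry_Suc)
  moreover have "psnd s = psnd t"
    using Suc.prems(3)[of 0] by (simp add: entry_0)
  ultimately show ?case
    by (metis pair_pfst_psnd)
qed

lemma recursive_fun_entry [rec_intros]:
  "recursive_fun f \<Longrightarrow> recursive_fun g \<Longrightarrow> recursive_fun (\<lambda>x. entry (f x) (g x))"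
  unfolding entry_def by (intro rec_intros)

lemma decidable_codes_seq [rec_intros]:
  "recursive_fun f \<Longrightarrow> recursive_fun g \<Longrightarrow> decidable (\<lambda>x. codes_seq (f x) (g x))"
  unfolding codes_seq_def by (intro rec_intros)

section \<open>Closure properties of \<open>\<Sigma>\<^sub>n\<close> and
  \<open>\<Pi>\<^sub>n\<close> predicates\<close>

text \<open>Negating the inner predicate makes the quantifiers alternate, so a single recursion
  suffices and the dual classes arise by complement.\<close>

fun sigma_pred :: "nat \<Rightarrow> (nat \<Rightarrow> bool) \<Rightarrow> bool" where
  "sigma_pred 0 P \<longleftrightarrow> decidable P"
| "sigma_pred (Suc n) P \<longleftrightarrow>
     (\<exists>Q. sigma_pred n Q \<and> (\<forall>x. P x \<longleftrightarrow> (\<exists>y. \<not> Q (pair x y))))"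

definition pi_pred :: "nat \<Rightarrow> (nat \<Rightarrow> bool) \<Rightarrow> bool" where
  "pi_pred n P \<longleftrightarrow> sigma_pred n (\<lambda>x. \<not> P x)"

lemma pi_pred_0: "pi_pred 0 P \<longleftrightarrow> decidable P"
  using decidable_not[of P] decidable_not[of "\<lambda>x. \<not> P x"] by (auto simp: pi_pred_def)

lemma sigma_not: "pi_pred n P \<Longrightarrow> sigma_pred n (\<lambda>x. \<not> P x)"
  by (simp add: pi_pred_def)

lemma pi_not: "sigma_pred n P \<Longrightarrow> pi_pred n (\<lambda>x. \<not> P x)"
  by (simp add: pi_pred_def)

lemma sigma_Suc_iff:
  "sigma_pred (Suc n) P \<longleftrightarrow> (\<exists>Q. pi_pred n Q \<and> (\<forall>x. P x \<longleftrightarrow> (\<exists>y. Q (pair x y))))"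
  (is "_ \<longleftrightarrow> ?R")
proof
  assume "sigma_pred (Suc n) P"
  then obtain Q where "sigma_pred n Q" "\<forall>x. P x \<longleftrightarrow> (\<exists>y. \<not> Q (pair x y))"
    by auto
  then show ?R
    by (intro exI[of _ "\<lambda>c. \<not> Q c"]) (simp add: pi_not)
next
  assume ?R
  then obtain Q where "pi_pred n Q" "\<forall>x. P x \<longleftrightarrow> (\<exists>y. Q (pair x y))"
    by auto
  then show "sigma_pred (Suc n) P"
    by (auto simp: pi_pred_def intro!: exI[of _ "\<lambda>c. \<not> Q c"])
qed

text \<open>Shaped for backward reasoning: stripping a quantifier passes to a coded pair, so that
  the level of an explicit formula can be read off by \<open>intro\<close>.\<close>

lemma sigma_ex:
  assumes "pi_pred n (\<lambda>c. Q (pfst c) (psnd c))"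
  shows "sigma_pred (Suc n) (\<lambda>x. \<exists>y. Q x y)"
  unfolding sigma_Suc_iff using assms by (intro exI[of _ "\<lambda>c. Q (pfst c) (psnd c)"]) simp

lemma pi_all:
  assumes "sigma_pred n (\<lambda>c. Q (pfst c) (psnd c))"
  shows "pi_pred (Suc n) (\<lambda>x. \<forall>y. Q x y)"
  using sigma_ex[of n "\<lambda>x y. \<not> Q x y"] assms by (simp add: pi_pred_def)

lemma sigma_subst: "sigma_pred n P \<Longrightarrow> recursive_fun f \<Longrightarrow> sigma_pred n (\<lambda>x. P (f x))"
proof (induction n arbitrary: P f)
  case 0
  then show ?case
    by (simp add: decidable_subst)
next
  case (Suc n)
  then obtain Q where Q: "sigma_pred n Q" "\<forall>x. P x \<longleftrightarrow> (\<exists>y. \<not> Q (pair x y))"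
    by auto
  have "sigma_pred n (\<lambda>c. Q (pair (f (pfst c)) (psnd c)))"
    by (intro Suc.IH[OF Q(1)] rec_intros recursive_fun_comp[OF Suc.prems(2)])
  then have "sigma_pred (Suc n) (\<lambda>x. \<exists>y. \<not> Q (pair (f x) y))"
    by (intro sigma_ex pi_not)
  with Q(2) show ?case
    by simp
qed

lemma pi_subst: "pi_pred n P \<Longrightarrow> recursive_fun f \<Longrightarrow> pi_pred n (\<lambda>x. P (f x))"
  unfolding pi_pred_def by (rule sigma_subst)

lemma sigma_Suc_of_pi: "pi_pred n P \<Longrightarrow> sigma_pred (Suc n) P"
  using sigma_ex[of n "\<lambda>x y. P x"] pi_subst[OF _ recursive_fun_pfst0] by simp

text \<open>A dummy quantifier lifts level 0; at higher levels the lift takes place in the inner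
  predicate.\<close>

lemma sigma_SucI: "sigma_pred n P \<Longrightarrow> sigma_pred (Suc n) P"
proof (induction n arbitrary: P)
  case 0
  then show ?case
    by (intro sigma_Suc_of_pi) (simp add: pi_pred_0)
next
  case (Suc n)
  then show ?case
    by (metis sigma_pred.simps(2))
qed

lemma pi_SucI: "pi_pred n P \<Longrightarrow> pi_pred (Suc n) P"
  unfolding pi_pred_def by (rule sigma_SucI)

lemma pi_Suc_of_sigma: "sigma_pred n P \<Longrightarrow> pi_pred (Suc n) P"
  using sigma_Suc_of_pi[OF pi_not[of n P]] by (simp add: pi_pred_def)

lemma sigma_decidable: "decidable P \<Longrightarrow> sigma_pred n P"
  by (induction n) (auto intro: sigma_SucI simp del: sigma_pred.simps(2))

lemma pi_decidable: "decidable P \<Longrightarrow> pi_pred n P"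
  unfolding pi_pred_def by (intro sigma_decidable decidable_not)

text \<open>Both claims are proved together, because the negation under the quantifier makes a
  conjunction at one level rest on a disjunction at the level below, and conversely.\<close>

lemma sigma_conj_disj:
  assumes "sigma_pred n P" "sigma_pred n Q"
  shows "sigma_pred n (\<lambda>x. P x \<and> Q x) \<and> sigma_pred n (\<lambda>x. P x \<or> Q x)"
  using assms
proof (induction n arbitrary: P Q)
  case 0
  then show ?case
    by (simp add: decidable_conj decidable_disj)
next
  case (Suc n)
  obtain P' where P': "sigma_pred n P'" "\<forall>x. P x \<longleftrightarrow> (\<exists>y. \<not> P' (pair x y))"
    using Suc.prems(1) by auto
  obtain Q' where Q': "sigma_pred n Q'" "\<forall>x. Q x \<longleftrightarrow> (\<exists>y. \<not> Q' (pair x y))"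
    using Suc.prems(2) by auto
  have P1: "sigma_pred n (\<lambda>c. P' (pair (pfst c) (pfst (psnd c))))"
    by (intro sigma_subst[OF P'(1)] rec_intros)
  have Q1: "sigma_pred n (\<lambda>c. Q' (pair (pfst c) (psnd (psnd c))))"
    by (intro sigma_subst[OF Q'(1)] rec_intros)
  \<comment> \<open>A conjunction needs two witnesses, coded as a pair; a disjunction gets by with a
    single one.\<close>
  have conj: "(\<lambda>x. P x \<and> Q x) =
      (\<lambda>x. \<exists>y. \<not> (P' (pair x (pfst y)) \<or> Q' (pair x (psnd y))))"
    using P'(2) Q'(2) by (metis pfst_pair psnd_pair)
  have disj: "(\<lambda>x. P x \<or> Q x) = (\<lambda>x. \<exists>y. \<not> (P' (pair x y) \<and> Q' (pair x y)))"
    using P'(2) Q'(2) by (intro ext) blast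
  have "sigma_pred (Suc n) (\<lambda>x. P x \<and> Q x)"
    unfolding conj by (intro sigma_ex pi_not Suc.IH[THEN conjunct2] P1 Q1)
  moreover have "sigma_pred (Suc n) (\<lambda>x. P x \<or> Q x)"
    unfolding disj using Suc.IH[OF P'(1) Q'(1)] by (intro sigma_ex pi_not) simp
  ultimately show ?case ..
qed

lemmas sigma_conj = sigma_conj_disj[THEN conjunct1]
lemmas sigma_disj = sigma_conj_disj[THEN conjunct2]

lemma pi_conj: "pi_pred n P \<Longrightarrow> pi_pred n Q \<Longrightarrow> pi_pred n (\<lambda>x. P x \<and> Q x)"
  using sigma_disj[of n "\<lambda>x. \<not> P x" "\<lambda>x. \<not> Q x"] by (simp add: pi_pred_def)

lemma pi_disj: "pi_pred n P \<Longrightarrow> pi_pred n Q \<Longrightarrow> pi_pred n (\<lambda>x. P x \<or> Q x)"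
  using sigma_conj[of n "\<lambda>x. \<not> P x" "\<lambda>x. \<not> Q x"] by (simp add: pi_pred_def)

lemma sigma_imp: "pi_pred n P \<Longrightarrow> sigma_pred n Q \<Longrightarrow> sigma_pred n (\<lambda>x. P x \<longrightarrow> Q x)"
  unfolding imp_conv_disj by (intro sigma_disj sigma_not)

lemma pi_imp: "sigma_pred n P \<Longrightarrow> pi_pred n Q \<Longrightarrow> pi_pred n (\<lambda>x. P x \<longrightarrow> Q x)"
  unfolding imp_conv_disj by (intro pi_disj pi_not)

text \<open>Two consecutive existential quantifiers are one quantifier over pairs.\<close>

lemma sigma_ex_contract:
  assumes "sigma_pred (Suc n) (\<lambda>c. Q (pfst c) (psnd c))"
  shows "sigma_pred (Suc n) (\<lambda>x. \<exists>y. Q x y)"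
proof -
  obtain R where R: "pi_pred n R" "\<And>c. Q (pfst c) (psnd c) \<longleftrightarrow> (\<exists>z. R (pair c z))"
    using assms unfolding sigma_Suc_iff by blast
  have eq: "(\<exists>y. Q x y) \<longleftrightarrow> (\<exists>c. R (pair (pair x (pfst c)) (psnd c)))" for x
    using R(2)[of "pair x y" for y] by (metis pfst_pair psnd_pair)
  show ?thesis
    unfolding eq by (intro sigma_ex pi_subst[OF R(1)] rec_intros)
qed

lemma pi_all_contract:
  assumes "pi_pred (Suc n) (\<lambda>c. Q (pfst c) (psnd c))"
  shows "pi_pred (Suc n) (\<lambda>x. \<forall>y. Q x y)"
  using sigma_ex_contract[of n "\<lambda>x y. \<not> Q x y"] assms by (simp add: pi_pred_def)

text \<open>At level 0 the bounded search is decidable; above it, the bound becomes a decidable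
  conjunct and the quantifier merges with the leading one.\<close>

lemma sigma_ex_less:
  assumes "sigma_pred n (\<lambda>c. Q (pfst c) (psnd c))" "recursive_fun m"
  shows "sigma_pred n (\<lambda>x. \<exists>k<m x. Q x k)"
proof (cases n)
  case 0
  with assms show ?thesis
    by (simp add: decidable_ex_less)
next
  case (Suc n')
  have "decidable (\<lambda>c. psnd c < m (pfst c))"
    by (intro rec_intros recursive_fun_comp[OF assms(2)])
  with assms show ?thesis
    unfolding Suc by (intro sigma_ex_contract sigma_conj[OF sigma_decidable])
qed

lemma pi_all_less:
  assumes "pi_pred n (\<lambda>c. Q (pfst c) (psnd c))" "recursive_fun m"
  shows "pi_pred n (\<lambda>x. \<forall>k<m x. Q x k)"
  using sigma_ex_less[of n "\<lambda>x k. \<not> Q x k" m] assms by (simp add: pi_pred_def)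

text \<open>Witnesses for all \<open>k < m x\<close> are collected into one sequence code, which
  moves the existential quantifier in front of the bounded universal one.\<close>

lemma sigma_all_less:
  assumes "sigma_pred n (\<lambda>c. Q (pfst c) (psnd c))" "recursive_fun m"
  shows "sigma_pred n (\<lambda>x. \<forall>k<m x. Q x k)"
proof (cases n)
  case 0
  with assms show ?thesis
    by (simp add: decidable_all_less)
next
  case (Suc n')
  obtain R where R: "pi_pred n' R" "\<And>c. Q (pfst c) (psnd c) \<longleftrightarrow> (\<exists>z. R (pair c z))"
    using assms(1) unfolding sigma_Suc_iff Suc by blast
  have Q: "Q x k \<longleftrightarrow> (\<exists>z. R (pair (pair x k) z))" for x k
    using R(2)[of "pair x k"] by simp
  have eq: "(\<forall>k<m x. Q x k) \<longleftrightarrow> (\<exists>s. \<forall>k<m x. R (pair (pair x k) (entry s k)))" for x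
  proof
    assume "\<forall>k<m x. Q x k"
    then obtain w where "\<forall>k<m x. R (pair (pair x k) (w k))"
      unfolding Q by metis
    with ex_codes_seq[of "m x" w] show "\<exists>s. \<forall>k<m x. R (pair (pair x k) (entry s k))"
      by metis
  qed (auto simp: Q)
  show ?thesis
    unfolding Suc eq
    by (intro sigma_ex pi_all_less pi_subst[OF R(1)] rec_intros recursive_fun_comp[OF assms(2)])
qed

text \<open>A witness \<open>y\<close> of \<open>\<exists>y. \<not> Q x y\<close> is made unique by taking the least one and coding along with it
  the (inductively unique) witnesses of \<open>Q x i\<close> for the \<open>i < y\<close>.\<close>

lemma sigma_unique:
  assumes "sigma_pred (Suc n) P"
  obtains Q where "pi_pred n Q" "\<And>x. P x \<longleftrightarrow> (\<exists>y. Q (pair x y))"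
    "\<And>x y z. Q (pair x y) \<Longrightarrow> Q (pair x z) \<Longrightarrow> y = z"
proof -
  have "\<exists>Q. pi_pred n Q \<and> (\<forall>x. P x \<longleftrightarrow> (\<exists>y. Q (pair x y))) \<and>
      (\<forall>x y z. Q (pair x y) \<longrightarrow> Q (pair x z) \<longrightarrow> y = z)"
    using assms
  proof (induction n arbitrary: P)
    case 0
    then obtain Q where Q: "decidable Q" "\<And>x. P x \<longleftrightarrow> (\<exists>y. \<not> Q (pair x y))"
      by auto
    \<comment> \<open>Each \<open>Q (pair x k)\<close> is decidable here, so leastness needs no
      further witnesses.\<close>
    define R where "R c \<longleftrightarrow> \<not> Q c \<and> (\<forall>k<psnd c. Q (pair (pfst c) k))" for c
    have "decidable R"
      unfolding R_def by (intro rec_intros Q(1) decidable_subst[OF Q(1)])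
    moreover have "P x \<longleftrightarrow> (\<exists>y. R (pair x y))" for x
      using exists_least_iff[of "\<lambda>y. \<not> Q (pair x y)"] Q(2)[of x] by (auto simp: R_def)
    moreover have "y = z" if "R (pair x y)" "R (pair x z)" for x y z
      using that by (cases y z rule: linorder_cases) (auto simp: R_def)
    ultimately show ?case
      by (auto simp: pi_pred_0)
  next
    case (Suc n)
    then obtain Q where Q: "sigma_pred (Suc n) Q" "\<And>x. P x \<longleftrightarrow> (\<exists>y. \<not> Q (pair x y))"
      by auto
    from Suc.IH[OF Q(1)] obtain R where R: "pi_pred n R" "\<And>c. Q c \<longleftrightarrow> (\<exists>v. R (pair c v))"
      "\<And>c v w. R (pair c v) \<Longrightarrow> R (pair c w) \<Longrightarrow> v = w"
      by blast
    define U where "U x y s \<longleftrightarrow> \<not> Q (pair x y) \<and> codes_seq y s \<and>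
        (\<forall>i<y. R (pair (pair x i) (entry s i)))" for x y s
    have pi: "pi_pred (Suc n) (\<lambda>c. U (pfst c) (pfst (psnd c)) (psnd (psnd c)))"
      unfolding U_def
      by (intro pi_conj pi_not pi_all_less sigma_subst[OF Q(1)] pi_subst[OF pi_SucI[OF R(1)]]
          rec_intros) (intro pi_decidable rec_intros)
    have ex: "P x \<longleftrightarrow> (\<exists>y s. U x y s)" for x
    proof
      assume "P x"
      then obtain y where y: "\<not> Q (pair x y)" "\<forall>i<y. Q (pair x i)"
        using exists_least_iff[of "\<lambda>y. \<not> Q (pair x y)"] Q(2)[of x] by auto
      then obtain w where w: "\<forall>i<y. R (pair (pair x i) (w i))"
        unfolding R(2) by metis
      obtain s where "codes_seq y s" "\<forall>i<y. entry s i = w i"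
        using ex_codes_seq by blast
      with y w have "U x y s"
        by (simp add: U_def)
      then show "\<exists>y s. U x y s"
        by blast
    qed (auto simp: U_def Q(2))
    have uniq: "y = z \<and> s = t" if "U x y s" "U x z t" for x y z s t
    proof -
      \<comment> \<open>If \<open>y < z\<close>, the sequence coded by \<open>t\<close> proves
        \<open>Q (pair x y)\<close>, contrary to \<open>U x y s\<close>; the other case is
        symmetric.\<close>
      have "\<not> y < z" "\<not> z < y"
        using that R(2) by (auto simp: U_def)
      then have "y = z"
        by simp
      moreover have "s = t"
        using that R(3) unfolding \<open>y = z\<close> U_def by (blast intro: codes_seq_inject)
      ultimately show ?thesis ..
    qed
    have "P x \<longleftrightarrow> (\<exists>y. U x (pfst y) (psnd y))" for x
      unfolding ex by (metis pfst_pair psnd_pair)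
    moreover have "y = z" if "U x (pfst y) (psnd y)" "U x (pfst z) (psnd z)" for x y z
      using uniq[OF that] by (metis pair_pfst_psnd)
    ultimately show ?case
      using pi by (intro exI[of _ "\<lambda>c. U (pfst c) (pfst (psnd c)) (psnd (psnd c))"]) auto
  qed
  with that show ?thesis
    by blast
qed

section \<open>Translation between predicates of one number and quantifier prefixes over
  lists\<close>

lemma ex_prefix_neg: "ex_prefix n (\<lambda>xs. \<not> R xs) xs \<longleftrightarrow> \<not> all_prefix n R xs"
  and all_prefix_neg: "all_prefix n (\<lambda>xs. \<not> R xs) xs \<longleftrightarrow> \<not> ex_prefix n R xs"
  by (induction n R xs and n R xs rule: ex_prefix_all_prefix.induct) auto

lemma recursive_rel_not: "recursive_rel n R \<Longrightarrow> recursive_rel n (\<lambda>xs. \<not> R xs)"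
proof -
  assume "recursive_rel n R"
  moreover have "(\<lambda>xs. of_bool (\<not> R xs)) = (\<lambda>xs. 1 - of_bool (R xs) :: nat)"
    by auto
  ultimately show ?thesis
    by (simp only: recursive_rel_def) (intro recursive_diff recursive_const)
qed

text \<open>A nonempty list is coded by left-nested pairs, so that appending an entry is one pairing.\<close>

definition enc :: "nat list \<Rightarrow> nat" where
  "enc xs = foldl (\<lambda>a b. pair a b) (hd xs) (tl xs)"

lemma enc_single [simp]: "enc [x] = x"
  by (simp add: enc_def)

lemma enc_snoc [simp]: "xs \<noteq> [] \<Longrightarrow> enc (xs @ [y]) = pair (enc xs) y"
  by (simp add: enc_def)

text \<open>Encoding prefixes keeps the arity \<open>m\<close> fixed while the induction runs over
  their length.\<close>

lemma recursive_enc_take: "k < m \<Longrightarrow> recursive m (\<lambda>xs. enc (take (Suc k) xs))"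
proof (induction k)
  case 0
  have "recursive m (\<lambda>xs. xs ! 0)"
    using 0 by (rule recursive.proj)
  then show ?case
    by (rule recursive.cong) (use 0 in \<open>auto simp: take_Suc hd_conv_nth\<close>)
next
  case (Suc k)
  have "recursive m (\<lambda>xs. pair (enc (take (Suc k) xs)) (xs ! Suc k))"
    using Suc by (intro recursive_pair recursive.proj) auto
  then show ?case
    by (rule recursive.cong) (use Suc in \<open>auto simp: take_Suc_conv_app_nth[of "Suc k"] intro!: enc_snoc\<close>)
qed

text \<open>Codes built by \<open>enc\<close> do not record the length of the list, so
  \<open>k\<close>, which is one less than it, is supplied from outside.\<close>

fun decoder :: "nat \<Rightarrow> nat \<Rightarrow> nat \<Rightarrow> nat" where
  "decoder 0 i c = c"
| "decoder (Suc k) i c = (if i = Suc k then psnd c else decoder k i (pfst c))"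

lemma recursive_fun_decoder: "recursive_fun (decoder k i)"
proof (induction k)
  case 0
  show ?case
    using recursive_fun_id by simp
next
  case (Suc k)
  have "decoder (Suc k) i = (if i = Suc k then psnd else (\<lambda>c. decoder k i (pfst c)))"
    by auto
  then show ?case
    using recursive_fun_comp[OF Suc recursive_fun_pfst0] recursive_fun_psnd0 by simp
qed

lemma decoder_enc: "length xs = Suc k \<Longrightarrow> i \<le> k \<Longrightarrow> decoder k i (enc xs) = xs ! i"
proof (induction k arbitrary: xs)
  case 0
  then show ?case
    by (auto simp: length_Suc_conv)
next
  case (Suc k)
  then obtain ys y where xs: "xs = ys @ [y]" "length ys = Suc k"
    by (metis length_Suc_conv_rev)
  from xs(2) have "ys \<noteq> []"
    by auto
  then show ?case
    using Suc xs by (auto simp: nth_append)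
qed

lemma map_decoder_enc:
  "length xs = Suc k \<Longrightarrow> map (\<lambda>i. decoder k i (enc xs)) [0..<Suc k] = xs"
  by (rule nth_equalityI) (simp_all add: decoder_enc del: upt_Suc)

text \<open>Each quantifier appends an argument, so the induction needs an arbitrary number
  \<open>Suc k\<close> of leading ones. Complementing \<open>R\<close> turns the remaining
  \<open>all_prefix\<close> into an \<open>ex_prefix\<close>, in accordance with the negation in
  \<open>sigma_pred\<close>.\<close>

lemma sigma_pred_of_prefix:
  "recursive_rel (Suc k + n) R \<Longrightarrow>
     \<exists>P. sigma_pred n P \<and> (\<forall>xs. length xs = Suc k \<longrightarrow> (P (enc xs) \<longleftrightarrow> ex_prefix n R xs))"
proof (induction n arbitrary: k R)
  case 0
  have "recursive 1 (\<lambda>ys. of_bool (R (map (\<lambda>g. g ys)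
      (map (\<lambda>i ys. decoder k i (ys ! 0)) [0..<Suc k]))))"
  proof (rule recursive.comp)
    show "recursive (Suc k) (\<lambda>xs. of_bool (R xs))"
      using 0 by (simp add: recursive_rel_def)
  qed (auto simp: recursive_fun_decoder[unfolded recursive_fun_def One_nat_def])
  then have "decidable (\<lambda>x. R (map (\<lambda>i. decoder k i x) [0..<Suc k]))"
    by (simp add: decidable_def recursive_fun_def comp_def del: upt_Suc)
  then show ?case
    by (intro exI[of _ "\<lambda>x. R (map (\<lambda>i. decoder k i x) [0..<Suc k])"])
      (simp add: map_decoder_enc del: upt_Suc)
next
  case (Suc n)
  then have "recursive_rel (Suc (Suc k) + n) (\<lambda>xs. \<not> R xs)"
    by (intro recursive_rel_not) simp
  from Suc.IH[OF this] obtain P where P: "sigma_pred n P"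
    "\<And>xs. length xs = Suc (Suc k) \<Longrightarrow> P (enc xs) \<longleftrightarrow> \<not> all_prefix n R xs"
    by (auto simp: ex_prefix_neg)
  have "(\<exists>y. \<not> P (pair (enc xs) y)) \<longleftrightarrow> ex_prefix (Suc n) R xs" if "length xs = Suc k" for xs
  proof -
    have "xs \<noteq> []"
      using that by auto
    then show ?thesis
      using P(2)[of "xs @ [y]" for y] that by simp
  qed
  with P(1) show ?case
    by (intro exI[of _ "\<lambda>x. \<exists>y. \<not> P (pair x y)"]) auto
qed

lemma prefix_of_sigma_pred:
  "sigma_pred n P \<Longrightarrow>
     \<exists>R. recursive_rel (Suc k + n) R \<and>
       (\<forall>xs. length xs = Suc k \<longrightarrow> (P (enc xs) \<longleftrightarrow> ex_prefix n R xs))"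
proof (induction n arbitrary: k P)
  case 0
  have "recursive (Suc k) (\<lambda>xs. of_bool (P (enc (take (Suc k) xs))))"
    using 0 by (intro recursive_comp1[OF _ recursive_enc_take])
      (auto simp: decidable_def recursive_fun_def)
  then show ?case
    by (intro exI[of _ "\<lambda>xs. P (enc (take (Suc k) xs))"]) (simp add: recursive_rel_def)
next
  case (Suc n)
  then obtain Q where Q: "sigma_pred n Q" "\<And>x. P x \<longleftrightarrow> (\<exists>y. \<not> Q (pair x y))"
    by auto
  from Suc.IH[OF Q(1), of "Suc k"] obtain R where R: "recursive_rel (Suc (Suc k) + n) R"
    "\<And>xs. length xs = Suc (Suc k) \<Longrightarrow> Q (enc xs) \<longleftrightarrow> ex_prefix n R xs"
    by blast
  have "P (enc xs) \<longleftrightarrow> ex_prefix (Suc n) (\<lambda>xs. \<not> R xs) xs" if "length xs = Suc k" for xs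
  proof -
    have "xs \<noteq> []"
      using that by auto
    then show ?thesis
      using R(2)[of "xs @ [y]" for y] that by (simp add: Q(2) all_prefix_neg)
  qed
  then show ?case
    using recursive_rel_not[OF R(1)] by (intro exI[of _ "\<lambda>xs. \<not> R xs"]) simp
qed

lemma Sigma0_iff: "Sigma0 n A \<longleftrightarrow> sigma_pred n (\<lambda>x. x \<in> A)"
proof
  assume "Sigma0 n A"
  then obtain R where R: "recursive_rel (Suc n) R" "\<And>x. x \<in> A \<longleftrightarrow> ex_prefix n R [x]"
    by (auto simp: Sigma0_def)
  from sigma_pred_of_prefix[of 0 n R] R(1) obtain P where
    P: "sigma_pred n P" "\<And>xs. length xs = Suc 0 \<Longrightarrow> P (enc xs) \<longleftrightarrow> ex_prefix n R xs"
    by auto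
  have "P = (\<lambda>x. x \<in> A)"
    using P(2)[of "[_]"] R(2) by auto
  with P(1) show "sigma_pred n (\<lambda>x. x \<in> A)"
    by simp
next
  assume "sigma_pred n (\<lambda>x. x \<in> A)"
  from prefix_of_sigma_pred[OF this, of 0] obtain R where R: "recursive_rel (Suc n) R"
    "\<And>xs. length xs = Suc 0 \<Longrightarrow> enc xs \<in> A \<longleftrightarrow> ex_prefix n R xs"
    by auto
  have "x \<in> A \<longleftrightarrow> ex_prefix n R [x]" for x
    using R(2)[of "[x]"] by simp
  with R(1) show "Sigma0 n A"
    by (auto simp: Sigma0_def)
qed

lemma re_iff_sigma: "re A \<longleftrightarrow> sigma_pred 1 (\<lambda>x. x \<in> A)"
proof
  assume "re A"
  then consider "A = {}" | f where "recursive_fun f" "A = range f"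
    by (auto simp: re_def)
  then show "sigma_pred 1 (\<lambda>x. x \<in> A)"
  proof cases
    case 1
    then show ?thesis
      by (simp add: sigma_decidable decidable_const del: One_nat_def)
  next
    case 2
    have "sigma_pred (Suc 0) (\<lambda>x. \<exists>y. x = f y)"
      by (intro sigma_ex pi_decidable rec_intros recursive_fun_comp[OF 2(1)])
    with 2(2) show ?thesis
      by (simp add: image_iff)
  qed
next
  assume "sigma_pred 1 (\<lambda>x. x \<in> A)"
  then obtain Q where Q: "decidable Q" "\<And>x. x \<in> A \<longleftrightarrow> (\<exists>y. Q (pair x y))"
    unfolding One_nat_def sigma_Suc_iff pi_pred_0 by blast
  show "re A"
  proof (cases "A = {}")
    case False
    then obtain a where "a \<in> A"
      by blast
    \<comment> \<open>A pair whose second component is a witness enumerates its first component; any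
      other number yields the default \<open>a\<close>.\<close>
    with Q(2) have "A = range (\<lambda>c. if Q c then pfst c else a)"
      by (auto simp: image_iff split: if_splits) (metis pair_pfst_psnd pfst_pair)+
    moreover have "recursive_fun (\<lambda>c. if Q c then pfst c else a)"
      by (intro rec_intros Q(1))
    ultimately show ?thesis
      unfolding re_def by blast
  qed (simp add: re_def)
qed

section \<open>The upper bound\<close>

lemma TD_pos_finite_iff:
  "TD_pos L F < \<infinity> \<longleftrightarrow> (\<exists>S. finite S \<and> pos_teaching_set S L F)"
  unfolding TD_pos_def INF_less_iff by simp

lemma I_cofin_TD_pos_iff:
  "e \<in> I_cofin_TD_pos W \<longleftrightarrow> finite {L \<in> family W e. \<not> TD_pos L (family W e) < \<infinity>}"
  by (simp add: I_cofin_TD_pos_def eventually_cofinite)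

text \<open>Exceptions are counted as languages: one index of each has to lie below
  \<open>k\<close>, and the equality of languages takes care of all its other indices.\<close>

lemma I_cofin_TD_pos_iff_index:
  "e \<in> I_cofin_TD_pos W \<longleftrightarrow>
     (\<exists>k. \<forall>j. (\<exists>i. i < k \<and> lang W e i = lang W e j) \<or> TD_pos (lang W e j) (family W e) < \<infinity>)"
  (is "_ \<longleftrightarrow> (\<exists>k. \<forall>j. ?P k j)")
proof
  let ?B = "{L \<in> family W e. \<not> TD_pos L (family W e) < \<infinity>}"
  assume "e \<in> I_cofin_TD_pos W"
  then have "finite ?B"
    by (simp only: I_cofin_TD_pos_iff)
  moreover have "?B \<subseteq> range (lang W e)"
    by (auto simp: family_def)
  ultimately obtain C where C: "finite C" "?B = lang W e ` C"
    by (auto dest: finite_subset_image)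
  from C(1) obtain k where k: "\<forall>i\<in>C. i < k"
    by (auto simp: finite_nat_set_iff_bounded)
  have "?P k j" for j
  proof (cases "lang W e j \<in> ?B")
    case True
    then obtain i where "i \<in> C" "lang W e j = lang W e i"
      using C(2) by blast
    with k show ?thesis
      by metis
  next
    case False
    then show ?thesis
      by (auto simp: family_def)
  qed
  then show "\<exists>k. \<forall>j. ?P k j"
    by blast
next
  assume "\<exists>k. \<forall>j. ?P k j"
  then obtain k where k: "\<And>j. ?P k j"
    by blast
  have "{L \<in> family W e. \<not> TD_pos L (family W e) < \<infinity>} \<subseteq> lang W e ` {..<k}"
  proof
    fix L assume "L \<in> {L \<in> family W e. \<not> TD_pos L (family W e) < \<infinity>}"
    then obtain j where "L = lang W e j" "\<not> TD_pos (lang W e j) (family W e) < \<infinity>"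
      by (auto simp: family_def)
    with k[of j] show "L \<in> lang W e ` {..<k}"
      by auto
  qed
  then show "e \<in> I_cofin_TD_pos W"
    unfolding I_cofin_TD_pos_iff by (rule finite_subset) simp
qed

text \<open>If some finite set teaches a language, then so does every larger finite subset of it, in
  particular a finite stage of its enumeration. This avoids quantifying over finite sets.\<close>

lemma TD_pos_finite_iff_stage:
  assumes "\<And>z. z \<in> W e \<longleftrightarrow> (\<exists>m. T z m)"
  shows "TD_pos (lang W e j) (family W e) < \<infinity> \<longleftrightarrow>
    (\<exists>n. \<forall>i. (\<forall>x<n. (\<exists>m<n. T (pair j x) m) \<longrightarrow> x \<in> lang W e i) \<longrightarrow> lang W e i = lang W e j)"
  (is "_ \<longleftrightarrow> (\<exists>n. ?P n)")
proof
  assume "TD_pos (lang W e j) (family W e) < \<infinity>"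
  then obtain S where fin: "finite S" and S: "pos_teaching_set S (lang W e j) (family W e)"
    unfolding TD_pos_finite_iff by blast
  have sub: "S \<subseteq> lang W e j"
    using S by (simp add: pos_teaching_set_def)
  have teach: "lang W e i = lang W e j" if "S \<subseteq> lang W e i" for i
    using S that by (auto simp: pos_teaching_set_def family_def)
  have "\<forall>x\<in>S. \<exists>m. T (pair j x) m"
    using sub assms by (auto simp: lang_def)
  then obtain w where w: "\<forall>x\<in>S. T (pair j x) (w x)"
    by metis
  from fin have "finite (S \<union> w ` S)"
    by simp
  \<comment> \<open>\<open>n\<close> exceeds both the members of \<open>S\<close> and the stages at
    which they appear, so stage \<open>n\<close> contains \<open>S\<close>.\<close>
  then obtain n where n: "\<forall>x \<in> S \<union> w ` S. x < n"
    by (auto simp: finite_nat_set_iff_bounded)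
  have "?P n"
  proof (intro allI impI)
    fix i assume "\<forall>x<n. (\<exists>m<n. T (pair j x) m) \<longrightarrow> x \<in> lang W e i"
    with w n have "S \<subseteq> lang W e i"
      by blast
    then show "lang W e i = lang W e j"
      by (rule teach)
  qed
  then show "\<exists>n. ?P n"
    by blast
next
  assume "\<exists>n. ?P n"
  then obtain n where n: "?P n"
    by blast
  let ?S = "{x. x < n \<and> (\<exists>m<n. T (pair j x) m)}"
  have "?S \<subseteq> lang W e j"
    by (auto simp: lang_def assms)
  moreover have "\<not> (\<exists>L\<in>family W e - {lang W e j}. ?S \<subseteq> L)"
    using n by (auto simp: family_def)
  ultimately have "pos_teaching_set ?S (lang W e j) (family W e)"
    by (simp add: pos_teaching_set_def)
  then show "TD_pos (lang W e j) (family W e) < \<infinity>"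
    unfolding TD_pos_finite_iff by (intro exI[of _ ?S]) simp
qed

lemma uniformly_re_iff: "uniformly_re V \<longleftrightarrow> sigma_pred 1 (\<lambda>c. psnd c \<in> V (pfst c))"
proof -
  have "{pair i x | i x. x \<in> V i} = {c. psnd c \<in> V (pfst c)}"
    by (auto, metis pair_pfst_psnd)
  then show ?thesis
    by (simp add: uniformly_re_def re_iff_sigma)
qed

lemma Sigma0_I_cofin_TD_pos:
  assumes "uniformly_re W"
  shows "Sigma0 5 (I_cofin_TD_pos W)"
proof -
  have sigma_W: "sigma_pred (Suc 0) (\<lambda>c. psnd c \<in> W (pfst c))"
    using assms by (simp only: uniformly_re_iff One_nat_def)
  then obtain T where T: "decidable T" "\<And>c. psnd c \<in> W (pfst c) \<longleftrightarrow> (\<exists>m. T (pair c m))"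
    unfolding sigma_Suc_iff pi_pred_0 by blast
  have W: "z \<in> W e \<longleftrightarrow> (\<exists>m. T (pair (pair e z) m))" for e z
    using T(2)[of "pair e z"] by simp
  have lang: "sigma_pred (Suc 0) (\<lambda>c. h c \<in> lang W (f c) (g c))"
    if "recursive_fun f" "recursive_fun g" "recursive_fun h" for f g h
    using sigma_subst[OF sigma_W, of "\<lambda>c. pair (f c) (pair (g c) (h c))"] that
    by (simp add: lang_def rec_intros del: sigma_pred.simps)
  note lang2 = sigma_SucI[OF lang] pi_Suc_of_sigma[OF lang]
  have eq: "pi_pred (Suc (Suc 0)) (\<lambda>c. lang W (f c) (g c) = lang W (f c) (h c))"
    if "recursive_fun f" "recursive_fun g" "recursive_fun h" for f g h
  proof -
    \<comment> \<open>Implications between \<open>\<Sigma>\<^sub>1\<close> conditions under a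
      universal quantifier are \<open>\<Pi>\<^sub>2\<close>.\<close>
    have "lang W e i = lang W e j \<longleftrightarrow>
        (\<forall>x. (x \<in> lang W e i \<longrightarrow> x \<in> lang W e j) \<and> (x \<in> lang W e j \<longrightarrow> x \<in> lang W e i))" for e i j
      by blast
    then show ?thesis
      by (simp only:) (intro pi_all_contract pi_conj pi_imp lang2 rec_intros
          that[THEN recursive_fun_comp])
  qed
  have stage: "decidable (\<lambda>c. \<exists>m<n c. T (pair (pair (f c) (pair (g c) (h c))) m))"
    if "recursive_fun f" "recursive_fun g" "recursive_fun h" "recursive_fun n" for f g h n
    by (intro rec_intros decidable_subst[OF T(1)] that[THEN recursive_fun_comp] that)
  \<comment> \<open>From the inside: the premise on stage \<open>n\<close> counts as
    \<open>\<Sigma>\<^sub>2\<close>, so the implication and its closure under \<open>i\<close> are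
    \<open>\<Pi>\<^sub>2\<close>, and being taught is \<open>\<Sigma>\<^sub>3\<close>. So is having
    an equal language below \<open>k\<close>; then \<open>j\<close> gives
    \<open>\<Pi>\<^sub>4\<close> and \<open>k\<close> gives \<open>\<Sigma>\<^sub>5\<close>.\<close>
  have "sigma_pred (Suc (Suc (Suc (Suc (Suc 0))))) (\<lambda>e. e \<in> I_cofin_TD_pos W)"
    unfolding I_cofin_TD_pos_iff_index TD_pos_finite_iff_stage[OF W]
    by (intro sigma_ex pi_all sigma_disj pi_conj pi_all_contract pi_imp eq
        sigma_all_less sigma_imp lang2 rec_intros)
      (intro pi_decidable stage rec_intros)+
  then show ?thesis
    by (simp only: Sigma0_iff eval_nat_numeral BitM.simps)
qed

section \<open>Hardness\<close>

text \<open>A member \<open>pair v (Suc (pair b t))\<close> enters \<open>main v\<close> once \<open>D v b\<close> is known to hold beyond \<open>t\<close>. The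
  set \<open>approx v a\<close> keeps one such marker of its own that is not yet in \<open>main v\<close>, and catches up with
  \<open>main v\<close> for as long as \<open>D v a\<close> goes on; so it equals \<open>main v\<close> if \<open>D v a\<close> holds everywhere, and
  otherwise is finite and taught by its last marker. The marker \<open>pair v 0\<close> separates different \<open>v\<close>.\<close>

locale gadget =
  fixes D :: "nat \<Rightarrow> nat \<Rightarrow> nat \<Rightarrow> bool"
  assumes D_0: "D v a 0"
    and D_antimono: "D v a t \<Longrightarrow> s \<le> t \<Longrightarrow> D v a s"
    and D_mono: "D v a t \<Longrightarrow> a \<le> b \<Longrightarrow> D v b t"
begin

definition main :: "nat \<Rightarrow> nat set" where
  "main v = {y. pfst y = v \<and>
     (psnd y = 0 \<or> D v (pfst (psnd y - 1)) (Suc (psnd (psnd y - 1))))}"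

text \<open>With \<open>q = psnd y - 1\<close>, the clause \<open>q \<le> a\<close> admits an
  initial part of \<open>main v\<close> unconditionally, so every finite subset of
  \<open>main v\<close> lies in \<open>approx v a\<close> for large \<open>a\<close>.\<close>

definition approx :: "nat \<Rightarrow> nat \<Rightarrow> nat set" where
  "approx v a = {y. pfst y = v \<and>
     (psnd y = 0 \<or>
      D v (pfst (psnd y - 1)) (Suc (psnd (psnd y - 1))) \<and> (psnd y - 1 \<le> a \<or> D v a (psnd y - 1)) \<or>
      pfst (psnd y - 1) = a \<and> D v a (psnd (psnd y - 1)))}"

definition lang_of :: "nat \<Rightarrow> nat set" where
  "lang_of j = (if psnd j = 0 then main (pfst j) else approx (pfst j) (psnd j - 1))"

lemma mem_main [simp]:
  "pair w 0 \<in> main v \<longleftrightarrow> w = v"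
  "pair w (Suc (pair b t)) \<in> main v \<longleftrightarrow> w = v \<and> D v b (Suc t)"
  by (auto simp: main_def)

lemma mem_approx [simp]:
  "pair w 0 \<in> approx v a \<longleftrightarrow> w = v"
  "pair w (Suc (pair b t)) \<in> approx v a \<longleftrightarrow> w = v \<and>
     (D v b (Suc t) \<and> (pair b t \<le> a \<or> D v a (pair b t)) \<or> b = a \<and> D v a t)"
  by (auto simp: approx_def)

lemma element_cases:
  obtains v where "y = pair v 0" | v b t where "y = pair v (Suc (pair b t))"
proof (cases "psnd y")
  case 0
  then show ?thesis
    using that(1)[of "pfst y"] by (metis pair_pfst_psnd)
next
  case (Suc q)
  then show ?thesis
    using that(2)[of "pfst y" "pfst q" "psnd q"] by (metis pair_pfst_psnd)
qed

lemma range_lang_of: "range lang_of = range main \<union> {approx v a | v a. True}"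
proof -
  have "main v \<in> range lang_of" for v
    by (rule range_eqI[of _ _ "pair v 0"]) (simp add: lang_of_def)
  moreover have "approx v a \<in> range lang_of" for v a
    by (rule range_eqI[of _ _ "pair v (Suc a)"]) (simp add: lang_of_def)
  moreover have "range lang_of \<subseteq> range main \<union> {approx v a | v a. True}"
    by (auto simp: lang_of_def)
  ultimately show ?thesis
    by blast
qed

lemma inj_main: "inj main"
  by (rule injI) (metis mem_main(1))

text \<open>The catching up never stops, and the markers with first component \<open>a\<close> all
  belong to \<open>main v\<close> anyway.\<close>

lemma approx_eq_main:
  assumes "\<forall>t. D v a t"
  shows "approx v a = main v"
proof (rule set_eqI)
  fix y show "y \<in> approx v a \<longleftrightarrow> y \<in> main v"
    using assms by (cases y rule: element_cases) auto
qed

lemma last_marker: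
  assumes "\<not> (\<forall>t. D v a t)"
  obtains t where "D v a t" "\<not> D v a (Suc t)"
  using assms D_0 by (metis nat_induct)

lemma finite_approx:
  assumes "\<not> (\<forall>t. D v a t)"
  shows "finite (approx v a)"
proof -
  obtain t where t: "\<not> D v a t"
    using assms by blast
  have less: "s < t" if "D v a s" for s
    using that t D_antimono by (meson not_le)
  \<comment> \<open>The three index sets match the clauses \<open>q \<le> a\<close>,
    \<open>D v a q\<close> and \<open>q = pair a s\<close> with \<open>D v a s\<close>; the failure
    of \<open>D v a\<close> at \<open>t\<close> bounds the latter two.\<close>
  have "approx v a \<subseteq> insert (pair v 0) ((\<lambda>q. pair v (Suc q)) ` ({..a} \<union> {..t} \<union> (\<lambda>s. pair a s) ` {..t}))"
  proof
    fix y assume "y \<in> approx v a"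
    then show "y \<in> insert (pair v 0) ((\<lambda>q. pair v (Suc q)) ` ({..a} \<union> {..t} \<union> (\<lambda>s. pair a s) ` {..t}))"
      by (cases y rule: element_cases) (auto dest!: less)
  qed
  then show ?thesis
    by (rule finite_subset) simp
qed

text \<open>The last marker is missing from \<open>main v\<close>, since
  \<open>D v a (Suc t)\<close> fails, and so no other approximation can catch up with it.\<close>

lemma approx_good:
  assumes "\<not> (\<forall>t. D v a t)"
  shows "TD_pos (approx v a) (range lang_of) < \<infinity>"
proof -
  obtain t where t: "D v a t" "\<not> D v a (Suc t)"
    using assms by (rule last_marker)
  let ?p = "pair v (Suc (pair a t))"
  have "L = approx v a" if "L \<in> range lang_of" "?p \<in> L" for L
    using that t unfolding range_lang_of by auto
  then have "pos_teaching_set {?p} (approx v a) (range lang_of)"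
    using t(1) by (auto simp: pos_teaching_set_def)
  then show ?thesis
    unfolding TD_pos_finite_iff by (intro exI[of _ "{?p}"]) simp
qed

text \<open>By \<open>D_mono\<close>, the approximations to \<open>main v\<close> that differ from
  it have indices below \<open>a\<close>. They are finite and \<open>main v\<close> is infinite, so
  each misses some element of \<open>main v\<close>; these finitely many elements, with
  \<open>pair v 0\<close> to exclude other \<open>v\<close>, teach \<open>main v\<close>.\<close>

lemma main_good:
  assumes "\<forall>t. D v a t"
  shows "TD_pos (main v) (range lang_of) < \<infinity>"
proof -
  have "inj (\<lambda>t. pair v (Suc (pair a t)))"
    by (rule injI) simp
  moreover have "range (\<lambda>t. pair v (Suc (pair a t))) \<subseteq> main v"
    using assms by auto
  ultimately have inf: "infinite (main v)"
    using finite_subset range_inj_infinite by blast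
  have "\<exists>y. y \<in> main v \<and> y \<notin> approx v b" if "\<not> (\<forall>t. D v b t)" for b
    using inf finite_approx[OF that] by (metis finite_subset subsetI)
  then obtain w where w: "\<And>b. \<not> (\<forall>t. D v b t) \<Longrightarrow> w b \<in> main v \<and> w b \<notin> approx v b"
    by metis
  let ?S = "insert (pair v 0) (w ` {b. b < a \<and> \<not> (\<forall>t. D v b t)})"
  have "L = main v" if "L \<in> range lang_of" "?S \<subseteq> L" for L
  proof -
    consider u where "L = main u" | u b where "L = approx u b"
      using \<open>L \<in> range lang_of\<close> unfolding range_lang_of by blast
    then show ?thesis
    proof cases
      case 1
      with \<open>?S \<subseteq> L\<close> show ?thesis
        by simp
    next
      case 2
      with \<open>?S \<subseteq> L\<close> have L: "L = approx v b"
        by simp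
      have "\<forall>t. D v b t"
      proof (rule ccontr)
        assume b: "\<not> (\<forall>t. D v b t)"
        then have "b < a"
          using assms D_mono by (meson not_le)
        with b \<open>?S \<subseteq> L\<close> have "w b \<in> L"
          by blast
        with w[OF b] L show False
          by blast
      qed
      with L show ?thesis
        by (simp add: approx_eq_main)
    qed
  qed
  moreover have "?S \<subseteq> main v"
    using w by auto
  ultimately have "pos_teaching_set ?S (main v) (range lang_of)"
    by (auto simp only: pos_teaching_set_def)
  moreover have "finite ?S"
    by simp
  ultimately show ?thesis
    unfolding TD_pos_finite_iff by blast
qed

text \<open>A finite subset of \<open>main v\<close> with all elements below \<open>n\<close> lies
  in \<open>approx v n\<close> by the clause with \<open>\<le>\<close>, yet the last marker of
  \<open>approx v n\<close> is not in \<open>main v\<close>.\<close>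

lemma main_bad:
  assumes "\<not> (\<exists>a. \<forall>t. D v a t)"
  shows "\<not> TD_pos (main v) (range lang_of) < \<infinity>"
proof
  assume "TD_pos (main v) (range lang_of) < \<infinity>"
  then obtain S where "finite S" and S: "pos_teaching_set S (main v) (range lang_of)"
    unfolding TD_pos_finite_iff by blast
  from \<open>finite S\<close> obtain n where n: "\<And>y. y \<in> S \<Longrightarrow> y < n"
    by (auto simp: finite_nat_set_iff_bounded)
  have "S \<subseteq> approx v n"
  proof
    fix y assume "y \<in> S"
    then have y: "y \<in> main v" "y < n"
      using S n by (auto simp: pos_teaching_set_def)
    then show "y \<in> approx v n"
    proof (cases y rule: element_cases)
      case (2 u b t)
      have "pair b t \<le> n"
        using y(2) le_prod_encode_2[of "Suc (pair b t)" u] unfolding 2 by simp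
      with y(1) show ?thesis
        unfolding 2 by simp
    qed simp
  qed
  moreover have "approx v n \<in> range lang_of"
    unfolding range_lang_of by blast
  ultimately have "approx v n = main v"
    using S by (auto simp: pos_teaching_set_def)
  moreover have "\<not> (\<forall>t. D v n t)"
    using assms by blast
  then obtain t where "D v n t" "\<not> D v n (Suc t)"
    by (rule last_marker)
  then have "pair v (Suc (pair n t)) \<in> approx v n - main v"
    by simp
  ultimately show False
    by blast
qed

text \<open>An approximation is taught or equals \<open>main v\<close>, so only sets
  \<open>main v\<close> are exceptions; injectivity of \<open>main\<close> turns counting them into
  counting \<open>v\<close>.\<close>

lemma finite_bad_iff:
  "finite {L \<in> range lang_of. \<not> TD_pos L (range lang_of) < \<infinity>} \<longleftrightarrow>
     finite {v. \<not> (\<exists>a. \<forall>t. D v a t)}"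
proof -
  have "{L \<in> range lang_of. \<not> TD_pos L (range lang_of) < \<infinity>} = main ` {v. \<not> (\<exists>a. \<forall>t. D v a t)}"
    (is "?B = main ` ?V")
  proof (intro equalityI subsetI)
    fix L assume "L \<in> ?B"
    then have L: "L \<in> range lang_of" "\<not> TD_pos L (range lang_of) < \<infinity>"
      by (simp_all only: mem_Collect_eq not_False_eq_True)
    have "\<exists>v. L = main v"
    proof (rule ccontr)
      assume not_main: "\<not> (\<exists>v. L = main v)"
      with L(1) obtain v a where a: "L = approx v a"
        unfolding range_lang_of by blast
      with L(2) have "\<forall>t. D v a t"
        by (metis approx_good)
      with not_main a show False
        by (metis approx_eq_main)
    qed
    then obtain v where v: "L = main v"
      by blast
    with L(2) have "\<not> (\<exists>a. \<forall>t. D v a t)"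
      by (metis main_good)
    with v show "L \<in> main ` ?V"
      by blast
  next
    fix L assume "L \<in> main ` ?V"
    then obtain v where v: "L = main v" "\<not> (\<exists>a. \<forall>t. D v a t)"
      by blast
    have "L \<in> range lang_of"
      unfolding v(1) range_lang_of by blast
    with main_bad[OF v(2)] show "L \<in> ?B"
      unfolding v(1) mem_Collect_eq by (rule conjI[rotated])
  qed
  then show ?thesis
    by (simp only: finite_image_iff[OF inj_on_subset[OF inj_main subset_UNIV]])
qed

end

section \<open>Reduction of an arbitrary \<open>\<Sigma>\<^sub>5\<close> set\<close>

lemma pi_Suc_iff:
  "pi_pred (Suc n) P \<longleftrightarrow> (\<exists>Q. sigma_pred n Q \<and> (\<forall>x. P x \<longleftrightarrow> (\<forall>y. Q (pair x y))))"
proof -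
  have "(\<not> P x \<longleftrightarrow> (\<exists>y. \<not> Q (pair x y))) \<longleftrightarrow> (P x \<longleftrightarrow> (\<forall>y. Q (pair x y)))" for Q x
    by blast
  then show ?thesis
    by (simp add: pi_pred_def)
qed

text \<open>If every \<open>Q y\<close> fails, the witnesses form sequences of every length. If
  \<open>Q y\<close> holds, position \<open>y\<close> has no witness, so lengths are at most
  \<open>y\<close>, and uniqueness leaves at most one sequence of each length.\<close>

lemma finite_sequences_iff:
  assumes P: "\<And>y. \<not> Q y \<longleftrightarrow> (\<exists>w. P y w)"
    and unique: "\<And>y w z. P y w \<Longrightarrow> P y z \<Longrightarrow> w = z"
  shows "finite {v. codes_seq (pfst v) (psnd v) \<and> (\<forall>i<pfst v. P i (entry (psnd v) i))} \<longleftrightarrow> (\<exists>y. Q y)"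
    (is "finite ?G \<longleftrightarrow> _")
proof
  assume "finite ?G"
  show "\<exists>y. Q y"
  proof (rule ccontr)
    assume "\<not> (\<exists>y. Q y)"
    with P obtain w where w: "\<And>y. P y (w y)"
      by metis
    have "y \<in> pfst ` ?G" for y
    proof -
      obtain s where "codes_seq y s" "\<forall>i<y. entry s i = w i"
        using ex_codes_seq by blast
      with w have "pair y s \<in> ?G"
        by simp
      then show ?thesis
        by (rule rev_image_eqI) simp
    qed
    then have "pfst ` ?G = UNIV"
      by blast
    with finite_imageI[OF \<open>finite ?G\<close>, of pfst] show False
      by (simp only: infinite_UNIV_nat)
  qed
next
  assume "\<exists>y. Q y"
  then obtain y where y: "\<And>w. \<not> P y w"
    using P by blast
  have "inj_on pfst ?G"
  proof (rule inj_onI)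
    fix u v assume uv: "u \<in> ?G" "v \<in> ?G" "pfst u = pfst v"
    have "psnd u = psnd v"
    proof (rule codes_seq_inject)
      fix i assume "i < pfst u"
      with uv show "entry (psnd u) i = entry (psnd v) i"
        by (intro unique[of i]) simp_all
    qed (use uv in auto)
    with uv(3) show "u = v"
      by (metis pair_pfst_psnd)
  qed
  moreover have "pfst ` ?G \<subseteq> {..y}"
    using y by (auto simp: not_less[symmetric])
  ultimately show "finite ?G"
    by (rule inj_on_finite) simp
qed

lemma many_one_reducible_I_cofin_TD_pos:
  assumes W: "acceptable_numbering W" and B: "Sigma0 5 B"
  shows "many_one_reducible B (I_cofin_TD_pos W)"
proof -
  have "sigma_pred (Suc (Suc (Suc (Suc (Suc 0))))) (\<lambda>x. x \<in> B)"
    using B by (simp only: Sigma0_iff eval_nat_numeral BitM.simps)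
  then obtain Q where Q: "pi_pred (Suc (Suc (Suc (Suc 0)))) Q" "\<And>x. x \<in> B \<longleftrightarrow> (\<exists>y. Q (pair x y))"
    unfolding sigma_Suc_iff[of "Suc (Suc (Suc (Suc 0)))"] by blast
  obtain P where P: "pi_pred (Suc (Suc (Suc 0))) P" "\<And>c. \<not> Q c \<longleftrightarrow> (\<exists>w. P (pair c w))"
    "\<And>c w z. P (pair c w) \<Longrightarrow> P (pair c z) \<Longrightarrow> w = z"
    using sigma_unique[OF sigma_not[OF Q(1)]] by blast
  define good where "good x v \<longleftrightarrow> codes_seq (pfst v) (psnd v) \<and>
      (\<forall>i<pfst v. P (pair (pair x i) (entry (psnd v) i)))" for x v
  have good: "finite {v. good x v} \<longleftrightarrow> x \<in> B" for x
    unfolding good_def Q(2)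
    by (rule finite_sequences_iff[of "\<lambda>y. Q (pair x y)" "\<lambda>y w. P (pair (pair x y) w)"])
      (use P in blast)+
  have "pi_pred (Suc (Suc (Suc 0))) (\<lambda>c. good (pfst c) (psnd c))"
    unfolding good_def
    by (intro pi_conj pi_all_less pi_subst[OF P(1)] rec_intros) (intro pi_decidable rec_intros)
  from sigma_not[OF this] obtain N where N: "pi_pred (Suc (Suc 0)) N"
    "\<And>c. \<not> good (pfst c) (psnd c) \<longleftrightarrow> (\<exists>a. N (pair c a))"
    unfolding sigma_Suc_iff[of "Suc (Suc 0)"] by blast
  from N(1) obtain R where R: "sigma_pred (Suc 0) R" "\<And>d. N d \<longleftrightarrow> (\<forall>t. R (pair d t))"
    unfolding pi_Suc_iff by blast
  \<comment> \<open>Bounding \<open>b\<close> by \<open>a\<close> makes \<open>D\<close> monotone in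
    \<open>a\<close>; bounding \<open>z\<close> by \<open>t\<close> makes it antimonotone in
    \<open>t\<close> and true at 0.\<close>
  define D where "D x v a t \<longleftrightarrow> (\<exists>b<Suc a. \<forall>z<t. R (pair (pair (pair x v) b) z))" for x v a t
  have gadget: "gadget (D x)" for x
  proof
    show "D x v a t \<Longrightarrow> a \<le> b \<Longrightarrow> D x v b t" for v a b t
      unfolding D_def by (metis Suc_le_mono order_less_le_trans)
  qed (auto simp: D_def)
  have D: "(\<exists>a. \<forall>t. D x v a t) \<longleftrightarrow> \<not> good x v" for x v
  proof -
    have "(\<exists>a. \<forall>t. D x v a t) \<longleftrightarrow> (\<exists>a. \<forall>t. R (pair (pair (pair x v) a) t))"
    proof
      assume "\<exists>a. \<forall>t. D x v a t"
      then obtain a where a: "\<And>t. D x v a t"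
        by blast
      show "\<exists>a. \<forall>t. R (pair (pair (pair x v) a) t)"
      proof (rule ccontr)
        assume "\<not> ?thesis"
        then obtain z where z: "\<And>b. \<not> R (pair (pair (pair x v) b) (z b))"
          by metis
        \<comment> \<open>A \<open>t\<close> beyond the counterexamples \<open>z b\<close> for all
          \<open>b \<le> a\<close> refutes \<open>D x v a t\<close>.\<close>
        have "finite (z ` {..a})"
          by simp
        then obtain t where "\<forall>y\<in>z ` {..a}. y < t"
          by (auto simp: finite_nat_set_iff_bounded)
        with a[of t] z show False
          by (auto simp: D_def less_Suc_eq_le)
      qed
    qed (auto simp: D_def)
    then show ?thesis
      using N(2)[of "pair x v"] by (simp add: R(2))
  qed
  have sigma_D: "sigma_pred (Suc 0) (\<lambda>c. D (f c) (g c) (h c) (k c))"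
    if "recursive_fun f" "recursive_fun g" "recursive_fun h" "recursive_fun k" for f g h k
    unfolding D_def
    by (intro sigma_ex_less sigma_all_less sigma_subst[OF R(1)] rec_intros that
        that[THEN recursive_fun_comp])
  define V where "V x = {c. psnd c \<in> gadget.lang_of (D x) (pfst c)}" for x
  \<comment> \<open>One formula for both kinds of languages, with \<open>D\<close> occurring only
    positively, shows that the languages are \<open>\<Sigma>\<^sub>1\<close> uniformly in
    \<open>x\<close> and \<open>j\<close>.\<close>
  have "y \<in> gadget.lang_of (D x) j \<longleftrightarrow> pfst y = pfst j \<and>
      (psnd y = 0 \<or>
       D x (pfst j) (pfst (psnd y - 1)) (Suc (psnd (psnd y - 1))) \<and>
         (psnd j = 0 \<or> psnd y - 1 \<le> psnd j - 1 \<or> D x (pfst j) (psnd j - 1) (psnd y - 1)) \<or>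
       psnd j \<noteq> 0 \<and> pfst (psnd y - 1) = psnd j - 1 \<and>
         D x (pfst j) (psnd j - 1) (psnd (psnd y - 1)))" for x y j
    by (auto simp: gadget.lang_of_def[OF gadget] gadget.main_def[OF gadget] gadget.approx_def[OF gadget])
  then have "sigma_pred (Suc 0) (\<lambda>c. psnd c \<in> V (pfst c))"
    unfolding V_def mem_Collect_eq
    by (simp only:) (intro sigma_conj sigma_disj sigma_D rec_intros;
        intro sigma_decidable rec_intros)
  then have "uniformly_re V"
    by (simp only: uniformly_re_iff One_nat_def)
  with W obtain f where f: "recursive_fun f" "\<And>x. V x = W (f x)"
    unfolding acceptable_numbering_def by blast
  have "family W (f x) = range (gadget.lang_of (D x))" for x
    by (auto simp: family_def lang_def V_def simp flip: f(2))
  then have "f x \<in> I_cofin_TD_pos W \<longleftrightarrow> finite {v. \<not> (\<exists>a. \<forall>t. D x v a t)}" for x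
    using gadget.finite_bad_iff[OF gadget, of x] by (simp only: I_cofin_TD_pos_iff)
  then show ?thesis
    unfolding many_one_reducible_def using f(1) good by (auto simp: D)
qed

theorem theorem10:
  fixes W :: "nat \<Rightarrow> nat set"
  assumes "acceptable_numbering W"
  shows "Sigma0_complete 5 (I_cofin_TD_pos W)"
  using assms Sigma0_I_cofin_TD_pos many_one_reducible_I_cofin_TD_pos
  by (auto simp: Sigma0_complete_def acceptable_numbering_def)

end
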